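(* Let $0<\pi_0<1$ and let $P_1,P_2,\dots$ be independent, absolutely continuous p-values with common distribution function $F(x)=\pi_0 x+(1-\pi_0)F_1(x)$, $x\in[0,1]$, where the null distribution is $\mathrm{Unif}[0,1]$ and $F_1$ is the distribution function of the p-values under the alternative. Let $\hat\pi_{0,BH}$ be the Benjamini–Hochberg estimator of $\pi_0$ computed from $P_1,\dots,P_n$. Then $\hat\pi_{0,BH}\to 1$ almost surely as $n\to\infty$.
   Context: The Benjamini–Hochberg (BH) estimator of the proportion $\pi_0$ of true null hypotheses is defined as follows. Let $P_{(1)}\le\dots\le P_{(n)}$ be the ordered values of $P_1,\dots,P_n$. For $i=1,\dots,n$ set $S_i=\dfrac{1-P_{(i)}}{n+1-i}$. Let $j=\inf\{i\ge 2: S_i<S_{i-1}\}$ (with $j=n$ if no such $i\le n$ exists). Put $\hat n_0=\min\left(\left[\tfrac{1}{S_j}+1\right],\,n\right)$, where $[\cdot]$ is the integer part, and $\hat\pi_{0,BH}=\hat n_0/n$. *)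

theory Defs
  imports "HOL-Probability.Probability"
begin

text \<open>
  The data are \<open>p 1, \<dots>, p n\<close>; all indices (of the data, of the order statistics and
  of the slopes) start at 1 and are meaningful in the range \<open>1 \<le> i \<le> n\<close> only.
\<close>

definition order_stat :: "nat \<Rightarrow> (nat \<Rightarrow> real) \<Rightarrow> nat \<Rightarrow> real" where
  "order_stat n p i = sort (map p [1..<Suc n]) ! (i - 1)"

definition bh_slope :: "nat \<Rightarrow> (nat \<Rightarrow> real) \<Rightarrow> nat \<Rightarrow> real" where
  "bh_slope n p i = (1 - order_stat n p i) / (real n + 1 - real i)"

definition bh_index :: "nat \<Rightarrow> (nat \<Rightarrow> real) \<Rightarrow> nat" where
  "bh_index n p =
     (if \<exists>i\<in>{2..n}. bh_slope n p i < bh_slope n p (i - 1)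
      then Inf {i \<in> {2..n}. bh_slope n p i < bh_slope n p (i - 1)}
      else n)"

text \<open>
  If the slope at the stopping index is 0 (i.e. the largest p-value is 1), then \<open>1 / 0\<close> is
  read as \<open>\<infinity>\<close> and the minimum is \<open>n\<close>.  In HOL, \<open>1 / 0 = 0\<close>, hence the case distinction.
\<close>

definition bh_n0 :: "nat \<Rightarrow> (nat \<Rightarrow> real) \<Rightarrow> int" where
  "bh_n0 n p =
     (let s = bh_slope n p (bh_index n p)
      in if s = 0 then int n else min \<lfloor>1 / s + 1\<rfloor> (int n))"

definition bh_pi0 :: "nat \<Rightarrow> (nat \<Rightarrow> real) \<Rightarrow> real" where
  "bh_pi0 n p = real_of_int (bh_n0 n p) / real n"

end

theory Submission
  imports Defs
begin

text \<open>
  The slopes satisfy \<open>S\<^sub>j \<le> 1 / (n + 1 - j)\<close>, so it suffices that the stopping index \<open>j\<close> is \<open>o(n)\<close>.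
  The slope drops at \<open>i\<close> as soon as the spacing between the order statistics \<open>i - 1\<close> and \<open>i\<close> is
  at least \<open>2 / n\<close> and \<open>i\<close> is at most about \<open>n / 2\<close>.  Cut a short interval \<open>[\<delta> / 2, \<delta>]\<close> into cells of
  length \<open>2 / n\<close>: a positive proportion of the order \<open>n\<close> cells has probability \<open>O(1 / n)\<close>, each of these is
  empty with probability bounded away from 0, and occupancies of disjoint cells are negatively
  dependent, so the probability that no cell is empty decays geometrically in \<open>n\<close>.  By
  Borel-Cantelli there is eventually an empty cell, whose right neighbour has rank at most about
  \<open>n F(\<delta>)\<close>, and \<open>F(\<delta>)\<close> tends to 0 with \<open>\<delta>\<close>.  The lower bound \<open>F(\<delta> / 2) \<ge> \<pi>\<^sub>0 \<delta> / 2 > 0\<close> ensures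
  that there are points to the left of the cell.
\<close>

subsection \<open>Occupancy and empirical frequencies\<close>

text \<open>Expanding the right-hand product over subsets of \<open>S\<close> gives nonnegative
  terms; the left side keeps those with at most one factor \<open>d s\<close>.\<close>

lemma prod_plus_first_order_le:
  fixes q d :: "'b \<Rightarrow> real"
  assumes "finite S" "\<And>s. s \<in> S \<Longrightarrow> 0 \<le> q s" "\<And>s. s \<in> S \<Longrightarrow> 0 \<le> d s"
  shows "prod q S + (\<Sum>s\<in>S. d s * prod q (S - {s})) \<le> (\<Prod>s\<in>S. q s + d s)"
  using assms
proof (induction S rule: finite_induct)
  case empty
  then show ?case by simp
next
  case (insert x S)
  have "prod q (insert x S - {s}) = q x * prod q (S - {s})" if "s \<in> S" for s
  proof -
    have "insert x S - {s} = insert x (S - {s})" using that insert by auto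
    then show ?thesis using insert by simp
  qed
  then have sum: "(\<Sum>s\<in>S. d s * prod q (insert x S - {s})) = q x * (\<Sum>s\<in>S. d s * prod q (S - {s}))"
    by (simp add: sum_distrib_left mult_ac)
  have x: "insert x S - {x} = S" using insert by auto
  have IH: "prod q S + (\<Sum>s\<in>S. d s * prod q (S - {s})) \<le> (\<Prod>s\<in>S. q s + d s)"
    using insert by auto
  have "prod q S \<le> (\<Prod>s\<in>S. q s + d s)"
    using insert.prems by (intro prod_mono) auto
  then have "d x * prod q S \<le> d x * (\<Prod>s\<in>S. q s + d s)"
    using insert.prems by (intro mult_left_mono) auto
  moreover have "q x * (prod q S + (\<Sum>s\<in>S. d s * prod q (S - {s}))) \<le> q x * (\<Prod>s\<in>S. q s + d s)"
    using IH insert.prems by (intro mult_left_mono) auto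
  ultimately show ?case
    using insert by (simp add: sum x algebra_simps)
qed

text \<open>Grouping the variables into the blocks \<open>I\<close> and \<open>{i}\<close> preserves
  independence, and the second block is \<open>X i\<close> up to a coordinate projection. Any
  measurable set \<open>A\<close> of vectors is allowed, so that joint occupancy events are
  covered.\<close>

lemma (in prob_space) prob_indep_insert:
  assumes indep: "indep_vars (\<lambda>_. N) X (insert i I)" and i: "i \<notin> I"
    and A: "A \<in> sets (Pi\<^sub>M I (\<lambda>_. N))" and B: "B \<in> sets N"
  shows "prob {\<omega>\<in>space M. restrict (\<lambda>j. X j \<omega>) I \<in> A \<and> X i \<omega> \<in> B}
    = prob {\<omega>\<in>space M. restrict (\<lambda>j. X j \<omega>) I \<in> A} * prob {\<omega>\<in>space M. X i \<omega> \<in> B}"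
proof -
  have "indep_var (Pi\<^sub>M I (\<lambda>_. N)) (\<lambda>\<omega>. restrict (\<lambda>j. X j \<omega>) I) (Pi\<^sub>M {i} (\<lambda>_. N)) (\<lambda>\<omega>. restrict (\<lambda>j. X j \<omega>) {i})"
    using i by (intro indep_var_restrict[OF indep]) auto
  moreover have "(\<lambda>f. f i) -` B \<inter> space (Pi\<^sub>M {i} (\<lambda>_. N)) \<in> sets (Pi\<^sub>M {i} (\<lambda>_. N))"
    using B by (intro measurable_sets[OF measurable_component_singleton]) auto
  moreover have "X i \<in> M \<rightarrow>\<^sub>M N"
    using indep by (auto simp: indep_vars_def)
  then have "restrict (\<lambda>j. X j \<omega>) {i} \<in> (\<lambda>f. f i) -` B \<inter> space (Pi\<^sub>M {i} (\<lambda>_. N)) \<longleftrightarrow> X i \<omega> \<in> B"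
    if "\<omega> \<in> space M" for \<omega>
    using that measurable_space[of "X i" M N] by (auto simp: space_PiM PiE_def)
  then have "{\<omega>\<in>space M. restrict (\<lambda>j. X j \<omega>) I \<in> A \<and> X i \<omega> \<in> B}
      = (\<lambda>\<omega>. (restrict (\<lambda>j. X j \<omega>) I, restrict (\<lambda>j. X j \<omega>) {i})) -`
        (A \<times> ((\<lambda>f. f i) -` B \<inter> space (Pi\<^sub>M {i} (\<lambda>_. N)))) \<inter> space M"
    and "{\<omega>\<in>space M. X i \<omega> \<in> B}
      = (\<lambda>\<omega>. restrict (\<lambda>j. X j \<omega>) {i}) -` ((\<lambda>f. f i) -` B \<inter> space (Pi\<^sub>M {i} (\<lambda>_. N))) \<inter> space M"
    and "{\<omega>\<in>space M. restrict (\<lambda>j. X j \<omega>) I \<in> A} = (\<lambda>\<omega>. restrict (\<lambda>j. X j \<omega>) I) -` A \<inter> space M"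
    by blast+
  ultimately show ?thesis
    using A by (simp only: indep_varD)
qed

text \<open>Conditioning on the cell of one variable gives a recursion whose solution is dominated by
  the product, because the latter also contains the higher-order terms dropped in
  \<open>prod_plus_first_order_le\<close>.\<close>
lemma (in prob_space) prob_all_cells_hit_le:
  assumes "finite I" and "indep_vars (\<lambda>_. N) X I" and "finite S"
    and "\<And>s. s \<in> S \<Longrightarrow> C s \<in> sets N" and "disjoint_family_on C S"
    and "\<And>i s. i \<in> I \<Longrightarrow> s \<in> S \<Longrightarrow> prob {\<omega>\<in>space M. X i \<omega> \<in> C s} = p s"
    and "\<And>s. s \<in> S \<Longrightarrow> p s \<in> {0..1}"
  shows "prob {\<omega>\<in>space M. \<forall>s\<in>S. \<exists>i\<in>I. X i \<omega> \<in> C s} \<le> (\<Prod>s\<in>S. 1 - (1 - p s) ^ card I)"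
  using assms
proof (induction I arbitrary: S rule: finite_induct)
  case empty
  show ?case
  proof (cases "S = {}")
    case False
    then have "(\<Prod>s\<in>S. 1 - (1 - p s) ^ card {}) = 0"
      using empty by auto
    then show ?thesis using False by auto
  qed simp
next
  case (insert i I)
  note S = insert.prems(3)
  have [measurable]: "X j \<in> M \<rightarrow>\<^sub>M N" if "j \<in> insert i I" for j
    using insert.prems(1) that unfolding indep_vars_def by auto
  define hit where "hit T = {\<omega>\<in>space M. \<forall>s\<in>T. \<exists>i\<in>I. X i \<omega> \<in> C s}" for T
  define q where "q s = 1 - (1 - p s) ^ card I" for s
  have indepI: "indep_vars (\<lambda>_. N) X I"
    using insert.prems(1) by (rule indep_vars_subset) auto
  have q: "0 \<le> q s" "q s \<le> 1" if "s \<in> S" for s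
    using insert.prems(6)[OF that] by (auto simp: q_def power_le_one)
  \<comment> \<open>Subsets are included because the new variable, once it lies in cell
    \<open>s\<close>, leaves only \<open>S - {s}\<close> to the old ones.\<close>
  have IH: "prob (hit T) \<le> prod q T" if "T \<subseteq> S" for T
    unfolding hit_def q_def
    using that insert.prems insert.hyps finite_subset[OF that] indepI disjoint_family_on_mono[OF that]
    by (intro insert.IH) auto
  have prod: "prob (hit T \<inter> {\<omega>\<in>space M. X i \<omega> \<in> B}) = prob (hit T) * prob {\<omega>\<in>space M. X i \<omega> \<in> B}"
    if T: "T \<subseteq> S" and B: "B \<in> sets N" for T B
  proof -
    define A where "A = {f\<in>space (Pi\<^sub>M I (\<lambda>_. N)). \<forall>s\<in>T. \<exists>j\<in>I. f j \<in> C s}"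
    have A: "A \<in> sets (Pi\<^sub>M I (\<lambda>_. N))"
    proof -
      have "{f\<in>space (Pi\<^sub>M I (\<lambda>_. N)). f j \<in> C s} \<in> sets (Pi\<^sub>M I (\<lambda>_. N))" if "j \<in> I" "s \<in> T" for j s
      proof -
        have "(\<lambda>f. f j) -` C s \<inter> space (Pi\<^sub>M I (\<lambda>_. N)) \<in> sets (Pi\<^sub>M I (\<lambda>_. N))"
          using S[of s] that T by (intro measurable_sets[OF measurable_component_singleton]) auto
        then show ?thesis by (simp add: vimage_def Int_def conj_commute)
      qed
      then show ?thesis
        unfolding A_def using finite_subset[OF T insert.prems(2)] insert.hyps(1)
        by (intro sets.sets_Collect_finite_All sets.sets_Collect_finite_Ex) auto
    qed
    have "restrict (\<lambda>j. X j \<omega>) I \<in> A \<longleftrightarrow> \<omega> \<in> hit T" if "\<omega> \<in> space M" for \<omega>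
      using that measurable_space[of "X _" M N] by (auto simp: A_def hit_def space_PiM PiE_def)
    then have "{\<omega>\<in>space M. restrict (\<lambda>j. X j \<omega>) I \<in> A \<and> X i \<omega> \<in> B} = hit T \<inter> {\<omega>\<in>space M. X i \<omega> \<in> B}"
      "{\<omega>\<in>space M. restrict (\<lambda>j. X j \<omega>) I \<in> A} = hit T"
      by (auto simp: hit_def)
    then show ?thesis
      using prob_indep_insert[OF insert.prems(1) insert.hyps(2) A B] by simp
  qed
  have hit_sets[measurable]: "hit T \<in> sets M" if "T \<subseteq> S" for T
  proof -
    have "{\<omega>\<in>space M. X j \<omega> \<in> C s} \<in> sets M" if "j \<in> I" "s \<in> T" for j s
    proof -
      have "X j -` C s \<inter> space M \<in> sets M"
        using S[of s] that \<open>T \<subseteq> S\<close> by (intro measurable_sets[of "X j" M N]) auto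
      then show ?thesis by (simp add: vimage_def Int_def conj_commute)
    qed
    then show ?thesis
      unfolding hit_def using finite_subset[OF \<open>T \<subseteq> S\<close> insert.prems(2)] insert.hyps(1)
      by (intro sets.sets_Collect_finite_All sets.sets_Collect_finite_Ex) auto
  qed
  have UN_sets[measurable]: "(\<Union>s\<in>S. C s) \<in> sets N"
    using S insert.prems(2) by (intro sets.finite_UN) auto
  let ?X = "\<lambda>B. {\<omega>\<in>space M. X i \<omega> \<in> B}"
  have X_sets: "?X B \<in> sets M" if [measurable]: "B \<in> sets N" for B
    by measurable
  have XC_sets: "?X (C s) \<in> sets M" if "s \<in> S" for s
    using S that by (intro X_sets) auto
  have "prob (?X (\<Union>s\<in>S. C s)) = prob (\<Union>s\<in>S. ?X (C s))"
    by (intro arg_cong[where f=prob]) auto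
  also have "\<dots> = (\<Sum>s\<in>S. prob (?X (C s)))"
    using insert.prems(2,4) XC_sets by (intro finite_measure_finite_Union) (auto simp: disjoint_family_on_def)
  also have "\<dots> = sum p S"
    using insert.prems(5) by (intro sum.cong) auto
  finally have UN: "prob (?X (\<Union>s\<in>S. C s)) = sum p S" .
  have "?X (space N - (\<Union>s\<in>S. C s)) = space M - ?X (\<Union>s\<in>S. C s)"
    using measurable_space[of "X i" M N] by auto
  then have compl: "prob (?X (space N - (\<Union>s\<in>S. C s))) = 1 - sum p S"
    using UN prob_compl[OF X_sets[OF UN_sets]] by simp
  \<comment> \<open>If the new variable lies in no cell, the old ones hit all of them; otherwise
    disjointness puts it in exactly one cell, and the old ones hit the rest.\<close>
  have "{\<omega>\<in>space M. \<forall>s\<in>S. \<exists>j\<in>insert i I. X j \<omega> \<in> C s}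
      \<subseteq> hit S \<inter> ?X (space N - (\<Union>s\<in>S. C s)) \<union> (\<Union>s\<in>S. hit (S - {s}) \<inter> ?X (C s))"
  proof
    fix \<omega> assume *: "\<omega> \<in> {\<omega>\<in>space M. \<forall>s\<in>S. \<exists>j\<in>insert i I. X j \<omega> \<in> C s}"
    have sp: "X i \<omega> \<in> space N" using * measurable_space[of "X i" M N] by auto
    show "\<omega> \<in> hit S \<inter> ?X (space N - (\<Union>s\<in>S. C s)) \<union> (\<Union>s\<in>S. hit (S - {s}) \<inter> ?X (C s))"
    proof (cases "\<exists>s\<in>S. X i \<omega> \<in> C s")
      case True
      then obtain s where s: "s \<in> S" "X i \<omega> \<in> C s" by auto
      then have "X i \<omega> \<notin> C t" if "t \<in> S - {s}" for t
        using insert.prems(4) that by (auto simp: disjoint_family_on_def)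
      then have "\<omega> \<in> hit (S - {s}) \<inter> ?X (C s)"
        using * s by (fastforce simp: hit_def)
      then show ?thesis using s by blast
    next
      case False
      then show ?thesis using * sp by (auto simp: hit_def)
    qed
  qed
  then have "prob {\<omega>\<in>space M. \<forall>s\<in>S. \<exists>j\<in>insert i I. X j \<omega> \<in> C s}
      \<le> prob (hit S \<inter> ?X (space N - (\<Union>s\<in>S. C s)) \<union> (\<Union>s\<in>S. hit (S - {s}) \<inter> ?X (C s)))"
    using X_sets XC_sets UN_sets hit_sets insert.prems(2)
    by (intro finite_measure_mono sets.Un sets.Int sets.finite_UN) auto
  also have "\<dots> \<le> prob (hit S \<inter> ?X (space N - (\<Union>s\<in>S. C s))) + prob (\<Union>s\<in>S. hit (S - {s}) \<inter> ?X (C s))"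
    using X_sets XC_sets UN_sets hit_sets insert.prems(2)
    by (intro measure_Un_le sets.Int sets.finite_UN) auto
  also have "\<dots> \<le> prob (hit S \<inter> ?X (space N - (\<Union>s\<in>S. C s))) + (\<Sum>s\<in>S. prob (hit (S - {s}) \<inter> ?X (C s)))"
    using X_sets XC_sets UN_sets hit_sets insert.prems(2)
    by (intro add_left_mono finite_measure_subadditive_finite) (auto intro!: sets.Int)
  also have "\<dots> = prob (hit S) * (1 - sum p S) + (\<Sum>s\<in>S. prob (hit (S - {s})) * p s)"
  proof -
    have "prob (hit S \<inter> ?X (space N - (\<Union>s\<in>S. C s))) = prob (hit S) * (1 - sum p S)"
      using prod[of S "space N - (\<Union>s\<in>S. C s)"] UN_sets by (simp only: compl order_refl sets.compl_sets)
    moreover have "prob (hit (S - {s}) \<inter> ?X (C s)) = prob (hit (S - {s})) * p s" if "s \<in> S" for s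
      using prod[of "S - {s}" "C s"] S insert.prems(5) that by auto
    ultimately show ?thesis by (intro arg_cong2[where f="(+)"] sum.cong) auto
  qed
  also have "\<dots> \<le> prod q S * (1 - sum p S) + (\<Sum>s\<in>S. prod q (S - {s}) * p s)"
  proof (intro add_mono mult_right_mono sum_mono IH)
    show "0 \<le> 1 - sum p S" using UN prob_le_1 by (metis diff_ge_0_iff_ge)
  qed (use insert.prems(6) in auto)
  \<comment> \<open>Splitting the factor \<open>q s\<close> off \<open>prod q S\<close> merges the
    two sums; the coefficients \<open>p s * (1 - q s)\<close> are the single-cell
    increments.\<close>
  also have "\<dots> = prod q S + (\<Sum>s\<in>S. p s * (1 - q s) * prod q (S - {s}))"
  proof -
    have "prod q S * sum p S = (\<Sum>s\<in>S. p s * q s * prod q (S - {s}))"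
      unfolding sum_distrib_left
      by (intro sum.cong refl) (subst prod.remove[OF insert.prems(2)], auto)
    then show ?thesis
      by (simp add: algebra_simps sum_subtractf)
  qed
  also have "\<dots> \<le> (\<Prod>s\<in>S. q s + p s * (1 - q s))"
    using q insert.prems(2,6) by (intro prod_plus_first_order_le) auto
  \<comment> \<open>\<open>q s + p s * (1 - q s) = 1 - (1 - p s) * (1 - q s)\<close>: one more
    variable adds one factor to the miss probability.\<close>
  also have "\<dots> = (\<Prod>s\<in>S. 1 - (1 - p s) ^ card (insert i I))"
    using insert.hyps by (simp add: q_def algebra_simps)
  finally show ?case .
qed

text \<open>By Markov's inequality, at least \<open>g\<close> of the cells have \<open>D\<close>-probability at most \<open>B / n\<close>.\<close>
lemma (in prob_space) prob_all_cells_hit_le_power: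
  assumes indep: "indep_vars (\<lambda>_. borel) X {1..n}"
    and distr: "\<And>i. i \<in> {1..n} \<Longrightarrow> distr M borel (X i) = D"
    and D: "prob_space D"
    and K: "finite K" and C: "\<And>k. k \<in> K \<Longrightarrow> C k \<in> sets borel" "disjoint_family_on C K"
    and B: "0 < B" "B \<le> real n" "B * (real (card K) - g) \<ge> real n"
    and \<gamma>: "\<gamma> \<le> (1 - B / real n) ^ n" "0 < \<gamma>" "\<gamma> < 1"
  shows "prob {\<omega>\<in>space M. \<forall>k\<in>K. \<exists>i\<in>{1..n}. X i \<omega> \<in> C k} \<le> (1 - \<gamma>) powr g"
proof -
  have n: "real n > 0" using B by linarith
  have X[measurable]: "X i \<in> borel_measurable M" if "i \<in> {1..n}" for i
    using indep that unfolding indep_vars_def by auto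
  have D_sets: "sets D = sets borel"
    using distr[of 1] n by (auto simp flip: distr)
  interpret D: prob_space D by fact
  define p where "p k = measure D (C k)" for k
  define G where "G = {k\<in>K. p k \<le> B / real n}"
  have p_sum: "sum p K \<le> 1"
  proof -
    have "sum p K = measure D (\<Union>k\<in>K. C k)"
      unfolding p_def using K C D_sets by (intro D.finite_measure_finite_Union[symmetric]) auto
    then show ?thesis by simp
  qed
  have "real (card (K - G)) * (B / real n) \<le> (\<Sum>k\<in>K - G. p k)"
    by (intro sum_bounded_below) (auto simp: G_def)
  also have "\<dots> \<le> sum p K"
    using K by (intro sum_mono2) (auto simp: p_def)
  finally have "real (card (K - G)) * (B / real n) \<le> 1"
    using p_sum by linarith
  then have "real (card (K - G)) * B \<le> real n"
    using n by (simp add: field_simps)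
  moreover have "card (K - G) = card K - card G" "card G \<le> card K"
    using K by (auto simp: G_def card_Diff_subset card_mono)
  then have "real (card (K - G)) * B = B * (real (card K) - real (card G))"
    by (simp add: of_nat_diff)
  \<comment> \<open>At most \<open>n / B\<close> cells are heavier than \<open>B / n\<close>, and
    the third bound on \<open>B\<close> makes this at most \<open>card K - g\<close>.\<close>
  ultimately have "B * (real (card K) - real (card G)) \<le> B * (real (card K) - g)"
    using B(3) by linarith
  then have G_card: "g \<le> real (card G)"
    using B by simp
  have prob_C: "prob {\<omega>\<in>space M. X i \<omega> \<in> C k} = p k" if "i \<in> {1..n}" "k \<in> K" for i k
    using measure_distr[OF X[OF that(1)] C(1)[OF that(2)]] distr[OF that(1)]
    by (simp add: p_def vimage_def Int_def conj_commute)
  have G: "finite G" "G \<subseteq> K" using K by (auto simp: G_def)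
  have meas: "{\<omega>\<in>space M. \<forall>k\<in>G. \<exists>i\<in>{1..n}. X i \<omega> \<in> C k} \<in> sets M"
  proof (intro sets.sets_Collect_finite_All sets.sets_Collect_finite_Ex)
    fix i k assume "k \<in> G" "i \<in> {1..n}"
    then have "X i -` C k \<inter> space M \<in> sets M"
      using C(1) G by (intro measurable_sets[OF X]) auto
    then show "{\<omega> \<in> space M. X i \<omega> \<in> C k} \<in> sets M"
      by (simp add: vimage_def Int_def conj_commute)
  qed (use G in auto)
  have "prob {\<omega>\<in>space M. \<forall>k\<in>K. \<exists>i\<in>{1..n}. X i \<omega> \<in> C k}
      \<le> prob {\<omega>\<in>space M. \<forall>k\<in>G. \<exists>i\<in>{1..n}. X i \<omega> \<in> C k}"
    using meas G by (intro finite_measure_mono) auto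
  also have "\<dots> \<le> (\<Prod>k\<in>G. 1 - (1 - p k) ^ card {1..n})"
  proof (rule prob_all_cells_hit_le[OF _ indep])
    show "disjoint_family_on C G" using C(2) G(2) by (rule disjoint_family_on_mono[rotated])
  qed (use G C prob_C in \<open>auto simp: p_def\<close>)
  also have "\<dots> \<le> (\<Prod>k\<in>G. 1 - \<gamma>)"
  proof (intro prod_mono conjI)
    fix k assume k: "k \<in> G"
    \<comment> \<open>A light cell is missed by all \<open>n\<close> points with probability at
      least \<open>\<gamma>\<close>; \<open>B \<le> real n\<close> keeps the base of the power
      nonnegative.\<close>
    have "(1 - B / real n) ^ n \<le> (1 - p k) ^ n"
      using k B n by (intro power_mono) (auto simp: G_def)
    then show "1 - (1 - p k) ^ card {1..n} \<le> 1 - \<gamma>" using \<gamma> by simp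
    show "0 \<le> 1 - (1 - p k) ^ card {1..n}"
      by (simp add: p_def power_le_one)
  qed
  also have "\<dots> = (1 - \<gamma>) powr real (card G)"
    using \<gamma> by (simp add: powr_realpow)
  also have "\<dots> \<le> (1 - \<gamma>) powr g"
    using G_card \<gamma> by (intro powr_mono') auto
  finally show ?thesis .
qed

text \<open>About \<open>l * n\<close> disjoint cells of length \<open>w / n\<close> fit into the
  interval. The probability that all are hit is eventually below a geometric sequence, hence
  summable, and Borel-Cantelli applies.\<close>

lemma (in prob_space) AE_eventually_empty_cell:
  fixes X :: "nat \<Rightarrow> 'a \<Rightarrow> real"
  assumes indep: "indep_vars (\<lambda>_. borel) X {1..}"
    and distr: "\<And>i. i \<ge> 1 \<Longrightarrow> distr M borel (X i) = D"
    and "c < d" "0 < w"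
  shows "AE \<omega> in M. \<forall>\<^sub>F n in sequentially.
    \<exists>a. c \<le> a \<and> a + w / real n \<le> d \<and> (\<forall>i\<in>{1..n}. X i \<omega> \<notin> {a<..a + w / real n})"
proof -
  have X[measurable]: "X i \<in> borel_measurable M" if "i \<ge> 1" for i
    using indep that unfolding indep_vars_def by auto
  have D: "prob_space D"
    using prob_space_distr[OF X[of 1]] distr[of 1] by simp
  define l where "l = (d - c) / w"
  have l: "0 < l" "l * w = d - c" using assms by (auto simp: l_def)
  \<comment> \<open>At most \<open>n / B = l * n / 4\<close> cells are heavy and
    \<open>l * n / 4\<close> light ones are wanted; the remaining \<open>l * n / 2\<close> absorbs
    the rounding in \<open>m n\<close> once \<open>2 \<le> l * n\<close>.\<close>
  define B where "B = 4 / l"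
  \<comment> \<open>Half the limit of \<open>(1 - B / n) ^ n\<close>, hence eventually below
    it.\<close>
  define \<gamma> where "\<gamma> = exp (- B) / 2"
  have B: "0 < B" using l by (simp add: B_def)
  have \<gamma>: "0 < \<gamma>" "\<gamma> < 1"
    using B exp_less_one_iff[of "-B"] by (auto simp: \<gamma>_def intro: order.strict_trans[of _ 1])
  define m where "m n = nat \<lfloor>l * real n\<rfloor>" for n
  define cell where "cell n k = {c + real k * (w / real n)<..c + real k * (w / real n) + w / real n}" for n k :: nat
  define A where "A n = {\<omega>\<in>space M. \<forall>k\<in>{..<m n}. \<exists>i\<in>{1..n}. X i \<omega> \<in> cell n k}" for n
  have A_sets: "A n \<in> sets M" for n
    unfolding A_def cell_def by measurable
  have "(\<lambda>n. (1 + (- B) / real n) ^ n) \<longlonglongrightarrow> exp (- B)"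
    by (rule tendsto_exp_limit_sequentially)
  then have "\<forall>\<^sub>F n in sequentially. \<gamma> < (1 + (- B) / real n) ^ n"
    by (rule order_tendstoD) (simp add: \<gamma>_def)
  moreover have "\<forall>\<^sub>F n in sequentially. B \<le> real n \<and> 2 \<le> l * real n"
    using eventually_ge_at_top[of "nat \<lceil>max B (2 / l)\<rceil>"]
  proof eventually_elim
    case (elim n)
    then have "max B (2 / l) \<le> real n" by linarith
    then show ?case using l by (simp add: field_simps)
  qed
  ultimately have "\<forall>\<^sub>F n in sequentially. norm (prob (A n)) \<le> ((1 - \<gamma>) powr (l / 4)) ^ n"
  proof eventually_elim
    case (elim n)
    have n: "real n > 0" using elim B by linarith
    have "prob (A n) \<le> (1 - \<gamma>) powr (l / 4 * real n)"
      unfolding A_def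
    proof (rule prob_all_cells_hit_le_power[OF _ _ D])
      show "indep_vars (\<lambda>_. borel) X {1..n}"
        using indep by (rule indep_vars_subset) auto
      show "disjoint_family_on (cell n) {..<m n}"
        unfolding disjoint_family_on_def
      proof (intro ballI impI)
        fix j k :: nat assume "j \<noteq> k"
        have *: "cell n j \<inter> cell n k = {}" if "j < k" for j k :: nat
        proof -
          have "(real j + 1) * (w / real n) \<le> real k * (w / real n)"
            using that \<open>0 < w\<close> n by (intro mult_right_mono) auto
          then have "c + real j * (w / real n) + w / real n \<le> c + real k * (w / real n)"
            by (simp only: distrib_right)
          then show ?thesis
            by (auto simp: cell_def simp del: times_divide_eq_right)
        qed
        show "cell n j \<inter> cell n k = {}"
          using *[of j k] *[of k j] \<open>j \<noteq> k\<close> by (auto simp: neq_iff)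
      qed
      have "real (m n) \<ge> l * real n - 1"
        unfolding m_def by linarith
      then have "l * real n / 4 \<le> real (m n) - l / 4 * real n"
        using elim by linarith
      then have "B * (l * real n / 4) \<le> B * (real (m n) - l / 4 * real n)"
        using B by (intro mult_left_mono) auto
      then show "real n \<le> B * (real (card {..<m n}) - l / 4 * real n)"
        using l by (simp add: B_def)
    qed (use B \<gamma> elim distr in \<open>auto simp: cell_def\<close>)
    also have "\<dots> = ((1 - \<gamma>) powr (l / 4)) ^ n"
      using \<gamma> by (simp only: powr_powr[symmetric]) (simp add: powr_realpow)
    finally show ?case by simp
  qed
  moreover have "(1 - \<gamma>) powr (l / 4) < 1"
    using \<gamma> l powr_less_mono'[of "1 - \<gamma>" 0 "l / 4"] by simp
  then have "summable (\<lambda>n. ((1 - \<gamma>) powr (l / 4)) ^ n)"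
    by (intro summable_geometric) auto
  ultimately have "summable (\<lambda>n. prob (A n))"
    by (rule summable_comparison_test_ev)
  then have "AE \<omega> in M. \<forall>\<^sub>F n in sequentially. \<omega> \<in> space M - A n"
    using A_sets by (intro borel_cantelli_AE1) (auto simp: less_top[symmetric])
  then show ?thesis
  proof eventually_elim
    case (elim \<omega>)
    from elim eventually_gt_at_top[of 0] show ?case
    proof eventually_elim
      case (elim n)
      then obtain k where k: "k < m n" "\<forall>i\<in>{1..n}. X i \<omega> \<notin> cell n k"
        by (auto simp: A_def)
      \<comment> \<open>The floor in \<open>m n\<close> keeps the right end of even the last cell
        within \<open>d\<close>.\<close>
      have "real k + 1 \<le> l * real n"
        using k(1) unfolding m_def by linarith
      then have "(real k + 1) * (w / real n) \<le> l * real n * (w / real n)"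
        using \<open>0 < w\<close> by (intro mult_right_mono) auto
      also have "\<dots> = d - c"
        using elim l by simp
      finally have "c + real k * (w / real n) + w / real n \<le> d"
        by (simp only: distrib_right mult_1_left)
      then show ?case
        using k \<open>0 < w\<close> by (intro exI[of _ "c + real k * (w / real n)"]) (auto simp: cell_def)
    qed
  qed
qed

text \<open>Hoeffding's inequality for the indicators of \<open>B\<close> gives a geometric bound on
  the deviation probability, and Borel-Cantelli concludes.\<close>

lemma (in prob_space) AE_eventually_frequency_close:
  assumes indep: "indep_vars (\<lambda>_. N) X {1..}" and B[measurable]: "B \<in> sets N"
    and p: "\<And>i. i \<ge> 1 \<Longrightarrow> prob {\<omega>\<in>space M. X i \<omega> \<in> B} = p" and "\<eta> > 0"
  shows "AE \<omega> in M. \<forall>\<^sub>F n in sequentially. \<bar>real (card {i\<in>{1..n}. X i \<omega> \<in> B}) - real n * p\<bar> < real n * \<eta>"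
proof -
  have X[measurable]: "X j \<in> M \<rightarrow>\<^sub>M N" if "j \<ge> 1" for j
    using indep that unfolding indep_vars_def by auto
  define Y :: "nat \<Rightarrow> 'a \<Rightarrow> real" where "Y i \<omega> = indicator B (X i \<omega>)" for i \<omega>
  have Y[measurable]: "Y i \<in> borel_measurable M" if "i \<ge> 1" for i
    using X[OF that] unfolding Y_def by measurable
  define A where "A n = {\<omega>\<in>space M. \<bar>(\<Sum>i\<in>{1..n}. Y i \<omega>) - real n * p\<bar> \<ge> real n * \<eta>}" for n
  have A: "A n \<in> sets M" for n
    unfolding A_def by measurable
  have bound: "prob (A n) \<le> 2 * exp (-2 * \<eta>\<^sup>2) ^ n" if "n > 0" for n
  proof -
    interpret Y: Hoeffding_ineq M "{1..n}" Y "\<lambda>_. 0" "\<lambda>_. 1" "\<Sum>i\<in>{1..n}. expectation (Y i)"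
    proof unfold_locales
      show "indep_vars (\<lambda>_. borel) Y {1..n}"
        unfolding Y_def by (rule indep_vars_compose2[OF indep_vars_subset[OF indep]]) auto
    qed (auto simp: Y_def indicator_def)
    have "expectation (Y i) = p" if "i \<ge> 1" for i
    proof -
      have "Y i \<omega> = indicator {\<omega>\<in>space M. X i \<omega> \<in> B} \<omega>" if "\<omega> \<in> space M" for \<omega>
        using that by (simp add: Y_def indicator_def)
      then have "expectation (Y i) = expectation (indicator {\<omega>\<in>space M. X i \<omega> \<in> B})"
        by (intro Bochner_Integration.integral_cong) auto
      also have "\<dots> = p" using p[OF that] X[OF that] by simp
      finally show ?thesis .
    qed
    then have \<mu>: "(\<Sum>i\<in>{1..n}. expectation (Y i)) = real n * p" by simp
    have "prob (A n) \<le> 2 * exp (-2 * (real n * \<eta>)\<^sup>2 / real n)"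
      using Y.Hoeffding_ineq_abs_ge[of "real n * \<eta>"] \<open>\<eta> > 0\<close> that
      unfolding A_def \<mu> by simp
    also have "-2 * (real n * \<eta>)\<^sup>2 / real n = real n * (-2 * \<eta>\<^sup>2)"
      using that by (simp add: power2_eq_square)
    also have "exp \<dots> = exp (-2 * \<eta>\<^sup>2) ^ n"
      by (rule exp_of_nat_mult)
    finally show ?thesis .
  qed
  have "summable (\<lambda>n. prob (A n))"
  proof (rule summable_comparison_test)
    show "\<exists>N. \<forall>n\<ge>N. norm (prob (A n)) \<le> 2 * exp (-2 * \<eta>\<^sup>2) ^ n"
      using bound by (intro exI[of _ 1]) auto
    show "summable (\<lambda>n. 2 * exp (-2 * \<eta>\<^sup>2) ^ n)"
      using \<open>\<eta> > 0\<close> by (intro summable_mult summable_geometric) auto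
  qed
  then have "AE \<omega> in M. \<forall>\<^sub>F n in sequentially. \<omega> \<in> space M - A n"
    using A by (intro borel_cantelli_AE1) (auto simp: less_top[symmetric])
  moreover have "(\<Sum>i\<in>{1..n}. Y i \<omega>) = real (card {i\<in>{1..n}. X i \<omega> \<in> B})" for n \<omega>
    by (simp add: Y_def indicator_def sum.If_cases Int_def)
  ultimately show ?thesis
    by (auto simp: A_def not_le elim!: eventually_mono)
qed

subsection \<open>The stopping index\<close>

lemma length_filter_sort_map_le:
  fixes p :: "nat \<Rightarrow> real"
  shows "length (filter (\<lambda>x. x \<le> a) (sort (map p [1..<Suc n]))) = card {i\<in>{1..n}. p i \<le> a}"
proof -
  have "length (filter (\<lambda>x. x \<le> a) (sort (map p [1..<Suc n]))) = length (filter (\<lambda>x. x \<le> a) (map p [1..<Suc n]))"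
    by (simp add: filter_sort)
  also have "\<dots> = length (filter (\<lambda>i. p i \<le> a) [1..<Suc n])"
    by (simp add: filter_map o_def del: upt_Suc)
  also have "\<dots> = card (set (filter (\<lambda>i. p i \<le> a) [1..<Suc n]))"
    by (rule distinct_card[symmetric]) simp
  also have "set (filter (\<lambda>i. p i \<le> a) [1..<Suc n]) = {i\<in>{1..n}. p i \<le> a}"
    by auto
  finally show ?thesis .
qed

text \<open>In a sorted list the positions of the entries up to \<open>a\<close> form an initial
  segment, whose length is the count.\<close>

lemma sorted_nth_le_iff:
  fixes xs :: "'b::linorder list"
  assumes "sorted xs" "i < length xs"
  shows "xs ! i \<le> a \<longleftrightarrow> i < length (filter (\<lambda>x. x \<le> a) xs)"
proof -
  define J where "J = {i. i < length xs \<and> xs ! i \<le> a}"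
  have J: "length (filter (\<lambda>x. x \<le> a) xs) = card J" "finite J"
    by (simp_all add: J_def length_filter_conv_card)
  show ?thesis
  proof
    assume "xs ! i \<le> a"
    then have "{..i} \<subseteq> J"
      using assms by (auto simp: J_def intro: order_trans[OF sorted_nth_mono])
    from card_mono[OF J(2) this] show "i < length (filter (\<lambda>x. x \<le> a) xs)"
      by (simp add: J)
  next
    assume "i < length (filter (\<lambda>x. x \<le> a) xs)"
    moreover have "J \<subseteq> {..<i}" if "\<not> xs ! i \<le> a"
    proof
      fix k assume "k \<in> J"
      then have "k < length xs" "xs ! k \<le> a" by (auto simp: J_def)
      then have "\<not> i \<le> k"
        using that sorted_nth_mono[OF assms(1), of i k] by auto
      then show "k \<in> {..<i}" by simp
    qed
    ultimately show "xs ! i \<le> a"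
      using J card_mono[of "{..<i}" J] by fastforce
  qed
qed

text \<open>Ranks invert counts; passing from zero-based positions to one-based ranks turns the
  strict inequality into a weak one.\<close>

lemma order_stat_le_iff:
  assumes "1 \<le> i" "i \<le> n"
  shows "order_stat n p i \<le> a \<longleftrightarrow> i \<le> card {k\<in>{1..n}. p k \<le> a}"
proof -
  have "order_stat n p i \<le> a \<longleftrightarrow> i - 1 < card {k\<in>{1..n}. p k \<le> a}"
    unfolding order_stat_def length_filter_sort_map_le[symmetric]
    using assms by (intro sorted_nth_le_iff) auto
  then show ?thesis using assms by auto
qed

lemma order_stat_in:
  assumes "1 \<le> i" "i \<le> n"
  shows "order_stat n p i \<in> p ` {1..n}"
proof -
  have "order_stat n p i \<in> set (sort (map p [1..<Suc n]))"
    unfolding order_stat_def using assms by (intro nth_mem) auto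
  also have "\<dots> = p ` {1..n}" by (auto simp del: upt_Suc)
  finally show ?thesis .
qed

section \<open>Bounds on the stopping index and the estimator\<close>

lemma bh_index_le:
  assumes "2 \<le> i" "i \<le> n" "bh_slope n p i < bh_slope n p (i - 1)"
  shows "bh_index n p \<le> i"
  using assms unfolding bh_index_def by (auto intro!: cInf_lower)

lemma bh_index_in:
  assumes "1 \<le> n"
  shows "1 \<le> bh_index n p" "bh_index n p \<le> n"
proof -
  let ?D = "{i \<in> {2..n}. bh_slope n p i < bh_slope n p (i - 1)}"
  \<comment> \<open>A nonempty set of naturals attains its infimum, so the stopping index is itself
    a drop in \<open>{2..n}\<close>.\<close>
  have D: "Inf ?D \<in> ?D" if "\<exists>i\<in>{2..n}. bh_slope n p i < bh_slope n p (i - 1)"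
    using that by (intro Inf_nat_def1) blast
  have "bh_index n p \<in> {1..n}"
  proof (cases "\<exists>i\<in>{2..n}. bh_slope n p i < bh_slope n p (i - 1)")
    case True
    then have "bh_index n p = Inf ?D" by (simp only: bh_index_def if_True)
    with D[OF True] show ?thesis by force
  qed (use assms in \<open>simp only: bh_index_def if_False, simp\<close>)
  then show "1 \<le> bh_index n p" "bh_index n p \<le> n"
    by auto
qed

text \<open>The slope drops exactly when a spacing exceeds the average \<open>(1 - P\<^sub>(\<^sub>i\<^sub>)) / (n + 1 - i)\<close> of
  the spacings that remain to the right; an empty cell of length \<open>2 / n\<close> forces this if at most
  half of the points lie to its left.\<close>
lemma bh_index_le_of_gap:
  assumes range: "\<And>i. i \<in> {1..n} \<Longrightarrow> p i \<in> {0..1}"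
    and empty: "\<And>i. i \<in> {1..n} \<Longrightarrow> p i \<notin> {a<..a + 2 / real n}"
    and r: "r = card {i\<in>{1..n}. p i \<le> a}" "1 \<le> r" "2 * r < n"
  shows "bh_index n p \<le> r + 1"
proof (rule bh_index_le)
  have rn: "r + 1 \<le> n" using r by simp
  let ?x = "order_stat n p r" and ?y = "order_stat n p (r + 1)"
  \<comment> \<open>Exactly \<open>r\<close> points are at most \<open>a\<close>, so
    \<open>?x\<close> and \<open>?y\<close> are its neighbours on either side, and the empty cell
    lies between them.\<close>
  have x: "?x \<le> a" using r by (subst order_stat_le_iff) auto
  have y: "\<not> ?y \<le> a" using r by (subst order_stat_le_iff) auto
  obtain i where i: "i \<in> {1..n}" "?y = p i"
    using order_stat_in[of "r + 1" n p] rn by auto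
  have y2: "a + 2 / real n < ?y" "0 \<le> ?y" "?y \<le> 1"
    using y empty[OF i(1)] range[OF i(1)] i(2) by auto
  \<comment> \<open>The slope denominators at \<open>r + 1\<close> and \<open>r\<close> are
    \<open>m\<close> and \<open>m + 1\<close>. After cross-multiplication the drop reads
    \<open>1 - ?y < m * (?y - ?x)\<close>; the right side exceeds 1 because
    \<open>n < 2 * m\<close>.\<close>
  define m where "m = real n - real r"
  have m: "real n < 2 * m" "0 < m" "real n > 0" using r by (auto simp: m_def)
  have "2 / real n < ?y - ?x" using y2 x by simp
  then have "m * (2 / real n) < m * (?y - ?x)"
    using m by (intro mult_strict_left_mono) auto
  moreover have "1 \<le> m * (2 / real n)"
    using m by (simp add: field_simps)
  ultimately have "1 - ?y < m * (?y - ?x)" using y2 by linarith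
  then have "(1 - ?y) / m < (1 - ?x) / (m + 1)"
    using m by (simp add: field_simps)
  then show "bh_slope n p (r + 1) < bh_slope n p (r + 1 - 1)"
    by (simp add: bh_slope_def m_def algebra_simps)
qed (use r in auto)

text \<open>The numerator of the slope at \<open>j\<close> is at most 1, so its reciprocal is at
  least \<open>n + 1 - j\<close>. The added 1 compensates the integer part, and the truncation at
  \<open>n\<close> is harmless as \<open>1 \<le> j\<close>. A zero slope gives \<open>n\<close> by
  convention.\<close>

lemma bh_pi0_ge:
  assumes range: "\<And>i. i \<in> {1..n} \<Longrightarrow> p i \<in> {0..1}" and n: "1 \<le> n"
  shows "bh_pi0 n p \<ge> 1 - (real (bh_index n p) - 1) / real n"
proof -
  define j where "j = bh_index n p"
  have j: "1 \<le> j" "j \<le> n" using bh_index_in[OF n] by (auto simp: j_def)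
  define s where "s = bh_slope n p j"
  obtain i where "i \<in> {1..n}" "order_stat n p j = p i"
    using order_stat_in[of j n p] j by auto
  with range have y: "0 \<le> order_stat n p j" "order_stat n p j \<le> 1" by auto
  define m where "m = real n + 1 - real j"
  have m: "0 < m" "m \<le> real n" using j by (auto simp: m_def)
  have s: "0 \<le> s" "s \<le> 1 / m"
    using y m by (auto simp: s_def bh_slope_def m_def[symmetric] divide_right_mono)
  have "m \<le> real_of_int (bh_n0 n p)"
  proof (cases "s = 0")
    case False
    with s have "0 < s" by simp
    then have "m \<le> 1 / s" using s m by (simp add: field_simps)
    also have "\<dots> \<le> real_of_int \<lfloor>1 / s + 1\<rfloor>" by linarith
    finally show ?thesis using m False
      by (simp add: bh_n0_def Let_def s_def[symmetric] j_def[symmetric] min_def)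
  qed (use m in \<open>simp add: bh_n0_def Let_def s_def[symmetric] j_def[symmetric]\<close>)
  then have "m / real n \<le> bh_pi0 n p"
    unfolding bh_pi0_def by (intro divide_right_mono) auto
  also have "m / real n = 1 - (real j - 1) / real n"
    using n by (simp add: m_def field_simps)
  finally show ?thesis by (simp add: j_def)
qed

lemma bh_pi0_le_1:
  "bh_pi0 n p \<le> 1"
  by (auto simp: bh_pi0_def bh_n0_def Let_def divide_le_eq_1 min_def)

subsection \<open>Almost sure convergence\<close>

text \<open>Complements the mixture formula, which prescribes the distribution function on
  \<open>{0..1}\<close> only.\<close>

lemma (in prob_space) cdf_distr_eq_outside_unit_interval:
  assumes X: "X \<in> borel_measurable M" and range: "AE \<omega> in M. X \<omega> \<in> {0..1}"
  shows "x < 0 \<Longrightarrow> cdf (distr M borel X) x = 0" "1 < x \<Longrightarrow> cdf (distr M borel X) x = (1::real)"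
proof -
  have cdf: "cdf (distr M borel X) x = prob {\<omega>\<in>space M. X \<omega> \<le> x}"
    using X by (simp add: cdf_def measure_distr vimage_def Int_def conj_commute)
  show "cdf (distr M borel X) x = 0" if "x < 0"
  proof -
    have "AE \<omega> in M. \<not> X \<omega> \<le> x" using range by eventually_elim (use that in auto)
    then show ?thesis unfolding cdf using X by (subst prob_Collect_eq_0) auto
  qed
  show "cdf (distr M borel X) x = 1" if "1 < x"
  proof -
    have "AE \<omega> in M. X \<omega> \<le> x" using range by eventually_elim (use that in auto)
    then show ?thesis
      unfolding cdf using X by (subst prob_Collect_eq_1) auto
  qed
qed

theorem theorem3p3:
  fixes M :: "'a measure"
    and P :: "nat \<Rightarrow> 'a \<Rightarrow> real"
    and \<pi>\<^sub>0 :: real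
    and N\<^sub>1 :: "real measure"
    and F\<^sub>1 :: "real \<Rightarrow> real"
  assumes "prob_space M"
    and "0 < \<pi>\<^sub>0" and "\<pi>\<^sub>0 < 1"
    and "prob_space.indep_vars M (\<lambda>_. borel) P {1..}"
    and "\<And>i. i \<ge> 1 \<Longrightarrow> AE \<omega> in M. P i \<omega> \<in> {0..1}"
    and "\<And>i. i \<ge> 1 \<Longrightarrow> absolutely_continuous lborel (distr M borel (P i))"
    and "real_distribution N\<^sub>1" and "AE x in N\<^sub>1. x \<in> {0..1}" and "F\<^sub>1 = cdf N\<^sub>1"
    and "\<And>i x. i \<ge> 1 \<Longrightarrow> x \<in> {0..1} \<Longrightarrow>
           cdf (distr M borel (P i)) x = \<pi>\<^sub>0 * x + (1 - \<pi>\<^sub>0) * F\<^sub>1 x"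
  shows "AE \<omega> in M. (\<lambda>n. bh_pi0 n (\<lambda>i. P i \<omega>)) \<longlonglongrightarrow> 1"
proof -
  interpret prob_space M by fact
  note indep = assms(4) and range = assms(5)
  have P[measurable]: "P i \<in> borel_measurable M" if "i \<ge> 1" for i
    using indep that unfolding indep_vars_def by auto
  define D where "D = distr M borel (P 1)"
  interpret D: real_distribution D
    unfolding D_def using P[of 1] by (intro real_distribution_distr) auto
  \<comment> \<open>Inside the unit interval the mixture formula does not depend on
    \<open>i\<close>; outside, the values are forced by the range.\<close>
  have distr: "distr M borel (P i) = D" if i: "i \<ge> 1" for i
  proof (rule cdf_unique)
    show "real_distribution (distr M borel (P i))" "real_distribution D"
      using P[OF i] D.real_distribution_axioms by (auto intro: real_distribution_distr)
    show "cdf (distr M borel (P i)) = cdf D"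
    proof
      fix x :: real
      consider "x < 0" | "x \<in> {0..1}" | "1 < x" by force
      then show "cdf (distr M borel (P i)) x = cdf D x"
        using cdf_distr_eq_outside_unit_interval[OF P range] i assms(10)[of i x] assms(10)[of 1 x]
        by cases (simp_all add: D_def)
    qed
  qed
  have prob_le: "prob {\<omega>\<in>space M. P i \<omega> \<in> {..x}} = cdf D x" if "i \<ge> 1" for i x
    using distr[OF that] P[OF that]
    by (simp add: cdf_def measure_distr vimage_def Int_def conj_commute flip: distr[OF that])
  \<comment> \<open>Absolute continuity excludes an atom at 0, which makes the distribution function
    continuous there.\<close>
  have "measure D {0} = 0"
  proof -
    have "{0} \<in> null_sets D"
      using assms(6)[of 1] finite_imp_null_set_lborel[of "{0}"]
      unfolding absolutely_continuous_def D_def by auto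
    then show ?thesis by (auto simp: measure_eq_0_null_sets)
  qed
  then have cont: "isCont (cdf D) 0" by (simp add: D.isCont_cdf)
  \<comment> \<open>The null component alone contributes \<open>\<pi>\<^sub>0 * x\<close>.\<close>
  have cdf_pos: "0 < cdf D x" if "0 < x" "x \<le> 1" for x
  proof -
    have "0 \<le> F\<^sub>1 x" by (simp add: assms(9) cdf_def)
    with assms(2,3) have "0 \<le> (1 - \<pi>\<^sub>0) * F\<^sub>1 x" by simp
    moreover have "0 < \<pi>\<^sub>0 * x" using assms(2) that by simp
    ultimately show ?thesis
      using assms(10)[of 1 x] that by (simp add: D_def)
  qed
  \<comment> \<open>By continuity, the value at 0 is the limit from the left, where the function
    vanishes.\<close>
  have cdf_0: "cdf D 0 = 0"
  proof -
    have "cdf D \<midarrow>0\<rightarrow> cdf D 0" using cont by (simp add: isCont_def)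
    then have "(cdf D \<longlongrightarrow> cdf D 0) (at_left 0)" by (rule filterlim_mono) (auto simp: at_le)
    moreover have "\<forall>\<^sub>F x in at_left 0. cdf D x = 0"
      using cdf_distr_eq_outside_unit_interval(1)[OF P range, of 1]
      by (auto simp: eventually_at_filter D_def)
    ultimately show ?thesis
      using tendsto_cong[of "cdf D" "\<lambda>_. 0"] tendsto_unique[of "at_left (0::real)"]
      by (metis tendsto_const trivial_limit_at_left_real)
  qed
  have range': "AE \<omega> in M. \<forall>i\<in>{1..}. P i \<omega> \<in> {0..1}"
    using range by (intro AE_ball_countable') auto
  have close: "AE \<omega> in M. \<forall>\<^sub>F n in sequentially. 1 - \<epsilon> \<le> bh_pi0 n (\<lambda>i. P i \<omega>)"
    if \<epsilon>: "0 < \<epsilon>" "\<epsilon> \<le> 1" for \<epsilon>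
  proof -
    have "\<forall>\<^sub>F x in at_right 0. cdf D x < \<epsilon> / 4"
      using cont \<epsilon> cdf_0
      by (intro order_tendstoD) (auto simp: isCont_def intro: filterlim_mono at_le)
    moreover have "\<forall>\<^sub>F x in at_right (0::real). x < 1"
      by (rule order_tendstoD[OF tendsto_ident_at]) simp
    moreover have "\<forall>\<^sub>F x in at_right (0::real). 0 < x"
      by (auto simp: eventually_at_filter)
    ultimately have "\<forall>\<^sub>F x in at_right (0::real). cdf D x < \<epsilon> / 4 \<and> 0 < x \<and> x < 1"
      by eventually_elim auto
    \<comment> \<open>Together with the frequency tolerance \<open>\<epsilon> / 4\<close> this keeps
      the rank \<open>r\<close> below \<open>n * \<epsilon> / 2\<close>, which also gives
      \<open>2 * r < n\<close> since \<open>\<epsilon> \<le> 1\<close>.\<close>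
    then obtain \<delta> where \<delta>: "cdf D \<delta> < \<epsilon> / 4" "0 < \<delta>" "\<delta> < 1"
      using eventually_happens'[of "at_right (0::real)"] trivial_limit_at_right_real by blast
    \<comment> \<open>With tolerance equal to the probability itself, the count cannot be 0; this
      yields \<open>1 \<le> r\<close>.\<close>
    have "AE \<omega> in M. \<forall>\<^sub>F n in sequentially.
        \<bar>real (card {i\<in>{1..n}. P i \<omega> \<in> {..\<delta> / 2}}) - real n * cdf D (\<delta> / 2)\<bar> < real n * cdf D (\<delta> / 2)"
      using cdf_pos[of "\<delta> / 2"] \<delta>
      by (intro AE_eventually_frequency_close[OF indep]) (auto simp: prob_le simp del: atMost_iff)
    moreover have "AE \<omega> in M. \<forall>\<^sub>F n in sequentially.
        \<bar>real (card {i\<in>{1..n}. P i \<omega> \<in> {..\<delta>}}) - real n * cdf D \<delta>\<bar> < real n * (\<epsilon> / 4)"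
      using \<epsilon> by (intro AE_eventually_frequency_close[OF indep]) (auto simp: prob_le simp del: atMost_iff)
    moreover have "AE \<omega> in M. \<forall>\<^sub>F n in sequentially.
        \<exists>a. \<delta> / 2 \<le> a \<and> a + 2 / real n \<le> \<delta> \<and> (\<forall>i\<in>{1..n}. P i \<omega> \<notin> {a<..a + 2 / real n})"
      using distr \<delta> by (intro AE_eventually_empty_cell[OF indep]) auto
    ultimately show ?thesis
      using range'
    proof eventually_elim
      case (elim \<omega>)
      note in_range = elim(4)
      from elim(1-3) eventually_gt_at_top[of 0] show ?case
      proof eventually_elim
        case (elim n)
        from elim(3) obtain a where a: "\<delta> / 2 \<le> a" "a + 2 / real n \<le> \<delta>"
          "\<And>i. i \<in> {1..n} \<Longrightarrow> P i \<omega> \<notin> {a<..a + 2 / real n}" by blast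
        define r where "r = card {i\<in>{1..n}. P i \<omega> \<le> a}"
        have n: "real n > 0" using elim by simp
        then have "a \<le> \<delta>" using a(2) by (smt (verit) divide_nonneg_pos)
        have "card {i\<in>{1..n}. P i \<omega> \<in> {..\<delta> / 2}} \<noteq> 0"
        proof
          assume "card {i\<in>{1..n}. P i \<omega> \<in> {..\<delta> / 2}} = 0"
          from elim(1)[unfolded this] show False by linarith
        qed
        moreover have "card {i\<in>{1..n}. P i \<omega> \<in> {..\<delta> / 2}} \<le> r"
          unfolding r_def using a(1) by (intro card_mono) auto
        ultimately have "1 \<le> r" by linarith
        have "real n * cdf D \<delta> \<le> real n * (\<epsilon> / 4)"
          using \<delta> n by (intro mult_left_mono) auto
        then have "real (card {i\<in>{1..n}. P i \<omega> \<in> {..\<delta>}}) < real n * \<epsilon> / 2"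
          using elim(2) by linarith
        moreover have "r \<le> card {i\<in>{1..n}. P i \<omega> \<in> {..\<delta>}}"
          unfolding r_def using \<open>a \<le> \<delta>\<close> by (intro card_mono) auto
        ultimately have r: "real r < real n * \<epsilon> / 2" by linarith
        moreover have "real n * \<epsilon> \<le> real n" using \<epsilon> n by (simp add: mult_left_le)
        ultimately have "2 * r < n" by linarith
        have P_range: "P i \<omega> \<in> {0..1}" if "i \<in> {1..n}" for i
          using in_range that by auto
        have "bh_index n (\<lambda>i. P i \<omega>) \<le> r + 1"
          using P_range a(3) r_def \<open>1 \<le> r\<close> \<open>2 * r < n\<close> by (rule bh_index_le_of_gap)
        then have "real (bh_index n (\<lambda>i. P i \<omega>)) \<le> real (r + 1)" by (rule of_nat_mono)
        moreover have "0 \<le> real n * \<epsilon>" using \<epsilon> by simp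
        ultimately have "real (bh_index n (\<lambda>i. P i \<omega>)) - 1 \<le> real n * \<epsilon>"
          using r by simp
        then have "(real (bh_index n (\<lambda>i. P i \<omega>)) - 1) / real n \<le> \<epsilon>"
          using n by (simp add: divide_le_eq mult.commute)
        moreover have "1 - (real (bh_index n (\<lambda>i. P i \<omega>)) - 1) / real n \<le> bh_pi0 n (\<lambda>i. P i \<omega>)"
          using P_range elim(4) by (intro bh_pi0_ge) auto
        ultimately show ?case by linarith
      qed
    qed
  qed
  \<comment> \<open>Countably many tolerances share one exceptional null set; the upper bound is
    \<open>bh_pi0_le_1\<close>.\<close>
  have "AE \<omega> in M. \<forall>m. \<forall>\<^sub>F n in sequentially. 1 - 1 / real (Suc m) \<le> bh_pi0 n (\<lambda>i. P i \<omega>)"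
    unfolding AE_all_countable by (intro allI close) auto
  then show ?thesis
  proof eventually_elim
    case (elim \<omega>)
    show ?case
    proof (rule tendstoI)
      fix e :: real assume "0 < e"
      then obtain m where m: "1 / real (Suc m) < e" using nat_approx_posE by blast
      from elim[rule_format, of m]
      show "\<forall>\<^sub>F n in sequentially. dist (bh_pi0 n (\<lambda>i. P i \<omega>)) 1 < e"
      proof eventually_elim
        case (elim n)
        with m bh_pi0_le_1[of n "\<lambda>i. P i \<omega>"] show ?case by (simp add: dist_real_def)
      qed
    qed
  qed
qed

end
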